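(* Let $K$ be a field and let $I$ be a matroidal ideal of degree $d$ in the polynomial ring $R=K[x_1,\dots,x_n]$ with $\mathrm{supp}(I)=\{x_1,\dots,x_n\}$. Then $q(I)=n-d$.
   Context: $R=K[x_1,\dots,x_n]$ is the polynomial ring in $n\ge 1$ variables over a field $K$, with each $\deg x_i=1$. For a monomial $u=x_1^{a_1}\cdots x_n^{a_n}$, $\mathrm{supp}(u)=\{x_i : a_i\neq 0\}$. For a monomial ideal $I$, $G(I)$ is its unique minimal set of monomial generators and $\mathrm{supp}(I)=\bigcup_{u\in G(I)}\mathrm{supp}(u)$. A monomial ideal $I$ is matroidal if every member of $G(I)$ is square-free and the following exchange condition holds: for any $u=x_1^{a_1}\cdots x_n^{a_n}$, $v=x_1^{b_1}\cdots x_n^{b_n}$ in $G(I)$, if $a_i>b_i$ for some $i$, then there is some $j$ with $a_j<b_j$ such that $x_ju/x_i\in G(I)$. All elements of $G(I)$ then have the same degree $d$, called the degree of $I$. A monomial ideal $I$ has linear quotients if there is an ordering $u_1,\dots,u_s$ of the monomials of $G(I)$ with $\deg u_1\le\cdots\le\deg u_s$ such that for each $2\le j\le s$ the colon ideal $\langle u_1,\dots,u_{j-1}\rangle:u_j$ is generated by a subset of $\{x_1,\dots,x_n\}$. For such an ordering, $q_j(I)$ is the number of variables required to generate $\langle u_1,\dots,u_{j-1}\rangle:u_j$, and $q(I)=\max\{q_j(I) : 2\le j\le s\}$ (with $q(I)=0$ if $s=1$). It is known that $q(I)$ does not depend on the choice of such an ordering, and that every matroidal ideal has linear quotients. *)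

theory Defs
  imports Complex_Main "HOL-Library.Poly_Mapping" "HOL-Library.Cardinality"
begin

text \<open>
  The variables are indexed by a finite type \<open>'n\<close>, so \<open>n = CARD('n) \<ge> 1\<close>. A monomial is
  represented by its exponent vector, and the ring \<open>K[x\<^sub>1,\<dots>,x\<^sub>n]\<close> is the monoid algebra of the
  exponent vectors over \<open>'k\<close>, whose multiplication is convolution.
\<close>

type_synonym 'n monomial = "'n \<Rightarrow>\<^sub>0 nat"
type_synonym ('n, 'k) polyring = "'n monomial \<Rightarrow>\<^sub>0 'k"

definition xpow :: "'n monomial \<Rightarrow> ('n, 'k::field) polyring" where
  "xpow u = Poly_Mapping.single u 1"

definition var_exp :: "'n \<Rightarrow> 'n monomial" where
  "var_exp i = Poly_Mapping.single i 1"

definition var :: "'n \<Rightarrow> ('n, 'k::field) polyring" where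
  "var i = xpow (var_exp i)"

definition mdeg :: "'n::finite monomial \<Rightarrow> nat" where
  "mdeg u = (\<Sum>i\<in>UNIV. Poly_Mapping.lookup u i)"

definition msupp :: "'n monomial \<Rightarrow> 'n set" where
  "msupp u = {i. Poly_Mapping.lookup u i \<noteq> 0}"

definition squarefree_monomial :: "'n monomial \<Rightarrow> bool" where
  "squarefree_monomial u \<longleftrightarrow> (\<forall>i. Poly_Mapping.lookup u i \<le> 1)"

text \<open>Ideals are submodules of the ring regarded as a module over itself.\<close>

lemma module_times: "module ((*) :: 'a::comm_ring_1 \<Rightarrow> 'a \<Rightarrow> 'a)"
  by unfold_locales (auto simp: algebra_simps)

definition ideal_gen :: "'a::comm_ring_1 set \<Rightarrow> 'a set" where
  "ideal_gen B = module.span (*) B"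

definition colon :: "'a::comm_ring_1 set \<Rightarrow> 'a \<Rightarrow> 'a set" where
  "colon I f = {g. g * f \<in> I}"

definition monomial_ideal :: "('n, 'k::field) polyring set \<Rightarrow> bool" where
  "monomial_ideal I \<longleftrightarrow> (\<exists>M. I = ideal_gen (xpow ` M))"

definition minimal_monomial_generators ::
    "('n, 'k::field) polyring set \<Rightarrow> 'n monomial set \<Rightarrow> bool" where
  "minimal_monomial_generators I M \<longleftrightarrow>
     I = ideal_gen (xpow ` M) \<and> (\<forall>M'. M' \<subset> M \<longrightarrow> I \<noteq> ideal_gen (xpow ` M'))"

definition min_gens :: "('n, 'k::field) polyring set \<Rightarrow> 'n monomial set" where
  "min_gens I = (THE M. minimal_monomial_generators I M)"

definition ideal_supp :: "('n, 'k::field) polyring set \<Rightarrow> 'n set" where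
  "ideal_supp I = (\<Union>u\<in>min_gens I. msupp u)"

text \<open>
  The exponent vector of \<open>x\<^sub>j u / x\<^sub>i\<close> is \<open>var_exp j + u - var_exp i\<close>; the truncated subtraction on
  the exponents is exact because \<open>x\<^sub>i\<close> divides \<open>u\<close> whenever \<open>a\<^sub>i > b\<^sub>i\<close>.
\<close>

definition matroidal :: "('n, 'k::field) polyring set \<Rightarrow> bool" where
  "matroidal I \<longleftrightarrow> monomial_ideal I \<and>
     (\<forall>u\<in>min_gens I. squarefree_monomial u) \<and>
     (\<forall>u\<in>min_gens I. \<forall>v\<in>min_gens I. \<forall>i.
        Poly_Mapping.lookup u i > Poly_Mapping.lookup v i \<longrightarrow>
        (\<exists>j. Poly_Mapping.lookup u j < Poly_Mapping.lookup v j \<and>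
             var_exp j + u - var_exp i \<in> min_gens I))"

text \<open>The common degree of the minimal generators; meaningful for nonzero equigenerated ideals.\<close>

definition ideal_degree :: "('n::finite, 'k::field) polyring set \<Rightarrow> nat" where
  "ideal_degree I = (THE d. \<forall>u\<in>min_gens I. mdeg u = d)"

text \<open>
  Lists are indexed from 0, so the \<open>u\<^sub>j\<close> with \<open>2 \<le> j \<le> s\<close> is \<open>us ! j\<close> with
  \<open>1 \<le> j < length us\<close>, preceded by the elements of \<open>take j us\<close>.
\<close>

definition step_colon :: "'n monomial list \<Rightarrow> nat \<Rightarrow> ('n, 'k::field) polyring set" where
  "step_colon us j = colon (ideal_gen (xpow ` set (take j us))) (xpow (us ! j))"

definition linear_quotient_ordering ::
    "('n::finite, 'k::field) polyring set \<Rightarrow> 'n monomial list \<Rightarrow> bool" where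
  "linear_quotient_ordering I us \<longleftrightarrow>
     set us = min_gens I \<and> distinct us \<and> sorted (map mdeg us) \<and>
     (\<forall>j\<in>{1..<length us}. \<exists>V.
        (step_colon us j :: ('n, 'k) polyring set) = ideal_gen (var ` V))"

definition q_step :: "('n::finite, 'k::field) polyring set \<Rightarrow> 'n monomial list \<Rightarrow> nat \<Rightarrow> nat" where
  "q_step I us j =
     (LEAST m. \<exists>V. card V = m \<and> (step_colon us j :: ('n, 'k) polyring set) = ideal_gen (var ` V))"

definition q_ordering :: "('n::finite, 'k::field) polyring set \<Rightarrow> 'n monomial list \<Rightarrow> nat" where
  "q_ordering I us =
     (if length us \<le> 1 then 0 else Max (q_step I us ` {1..<length us}))"

text \<open>
  The ideal argument of the preceding two definitions only fixes the coefficient field. The next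
  definition relies on the maximum being the same for every admissible ordering.
\<close>

definition q_ideal :: "('n::finite, 'k::field) polyring set \<Rightarrow> nat" where
  "q_ideal I = (THE r. \<exists>us. linear_quotient_ordering I us \<and> r = q_ordering I us)"

end

theory Submission
  imports Defs
begin

text \<open>
  A square-free monomial is the same thing as its support, so the minimal generators of a
  matroidal ideal are encoded by a family of subsets of the variables that satisfies the basis
  exchange property; all members then have the same size \<open>d\<close>
  (\<open>exchange_family_card_eq\<close>). If \<open>B\<^sub>1, \<dots>, B\<^sub>s\<close> are the supports in the order of the
  generators, the \<open>j\<close>-th colon ideal contains the variable \<open>x\<^sub>l\<close> exactly when some earlier
  \<open>B\<^sub>k\<close> is contained in \<open>B\<^sub>j \<union> {l}\<close>. Hence, whenever that colon ideal is generated by variables,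
  the generating variables are the \<open>x\<^sub>l\<close> with this property (\<open>step_vars\<close>), and \<open>q\<^sub>j\<close> counts them.

  Such an \<open>l\<close> cannot lie in \<open>B\<^sub>j\<close>, because then \<open>B\<^sub>k \<subseteq> B\<^sub>j\<close> would force \<open>B\<^sub>k = B\<^sub>j\<close>. So every
  \<open>q\<^sub>j\<close> is at most \<open>n - d\<close> (\<open>step_vars_disjoint\<close>). At the last step the bound is attained: every
  variable occurs in some generator, so by exchange each \<open>l\<close> outside \<open>B\<^sub>s\<close> can replace an element
  of \<open>B\<^sub>s\<close>, and the resulting generator comes before the last one (\<open>step_vars_last\<close>). The maximum
  is therefore \<open>n - d\<close> for every ordering with linear quotients, which includes the independence of
  the ordering that makes \<open>q(I)\<close> meaningful.

  What remains is that such an ordering exists. Number the variables and sort the generators by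
  the binary number whose digits are given by the support. For an earlier \<open>B\<^sub>i\<close>, the
  largest element \<open>m\<close> of the symmetric difference of \<open>B\<^sub>i\<close> and \<open>B\<^sub>j\<close> belongs to \<open>B\<^sub>j\<close>, and exchanging
  \<open>m\<close> for some \<open>l \<in> B\<^sub>i - B\<^sub>j\<close> lowers the number. So \<open>x\<^sub>l\<close> is in the colon ideal and divides the
  generator contributed by \<open>B\<^sub>i\<close> (\<open>matroidal_linear_quotient_ordering\<close>).
\<close>

section \<open>Families of finite sets with the exchange property\<close>

definition exchange_family :: "'a set set \<Rightarrow> bool" where
  "exchange_family \<B> \<longleftrightarrow>
     (\<forall>X\<in>\<B>. \<forall>Y\<in>\<B>. \<forall>i\<in>X - Y. \<exists>j\<in>Y - X. insert j (X - {i}) \<in> \<B>)"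

lemma exchange_familyE:
  assumes "exchange_family \<B>" "X \<in> \<B>" "Y \<in> \<B>" "i \<in> X" "i \<notin> Y"
  obtains j where "j \<in> Y" "j \<notin> X" "insert j (X - {i}) \<in> \<B>"
  using assms unfolding exchange_family_def by blast

lemma card_exchange:
  assumes "finite X" "i \<in> X" "j \<notin> X"
  shows "card (insert j (X - {i})) = card X"
  using assms card.remove[of X i] by simp

text \<open>
  Exchanging elements of \<open>X - Y\<close> for elements of \<open>Y - X\<close> keeps the size of \<open>X\<close> and shrinks
  \<open>X - Y\<close> until \<open>X \<subseteq> Y\<close>. The inclusion cannot be proper, since an element of \<open>Y - X\<close> would have
  nothing in \<open>X - Y\<close> to be exchanged for.
\<close>

lemma exchange_family_card_eq:
  fixes X Y :: "'a::finite set"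
  assumes ex: "exchange_family \<B>" and "X \<in> \<B>" "Y \<in> \<B>"
  shows "card X = card Y"
  using \<open>X \<in> \<B>\<close>
proof (induction "card (X - Y)" arbitrary: X rule: less_induct)
  case less
  show ?case
  proof (cases "X \<subseteq> Y")
    case True
    have "X = Y"
    proof (rule ccontr)
      assume "X \<noteq> Y"
      then obtain i where "i \<in> Y" "i \<notin> X" using True by blast
      then obtain j where "j \<in> X" "j \<notin> Y"
        using exchange_familyE[OF ex \<open>Y \<in> \<B>\<close> less.prems] by metis
      then show False using True by blast
    qed
    then show ?thesis by simp
  next
    case False
    then obtain i where i: "i \<in> X" "i \<notin> Y" by blast
    then obtain j where j: "j \<in> Y" "j \<notin> X" "insert j (X - {i}) \<in> \<B>"
      using exchange_familyE[OF ex less.prems \<open>Y \<in> \<B>\<close>] by metis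
    have "insert j (X - {i}) - Y \<subset> X - Y" using i j by auto
    then have "card (insert j (X - {i}) - Y) < card (X - Y)"
      by (rule psubset_card_mono[OF finite])
    from less.hyps[OF this j(3)] show ?thesis
      using card_exchange[OF finite i(1) j(2)] by simp
  qed
qed

text \<open>
  The exchange property prescribes the element that leaves; this is the form that prescribes the
  element that enters. Among the members containing \<open>l\<close>, move \<open>Y\<close> towards \<open>X\<close> by exchanging
  away elements of \<open>Y - X\<close> other than \<open>l\<close>. When only \<open>l\<close> is left, equality of sizes makes
  \<open>X - Y\<close> a single element, the one that \<open>l\<close> replaces.
\<close>

lemma exchange_family_insert_point:
  fixes X Y :: "'a::finite set"
  assumes ex: "exchange_family \<B>" and "X \<in> \<B>" "Y \<in> \<B>" "l \<in> Y" "l \<notin> X"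
  shows "\<exists>b\<in>X. insert l (X - {b}) \<in> \<B>"
  using \<open>Y \<in> \<B>\<close> \<open>l \<in> Y\<close>
proof (induction "card (Y - X)" arbitrary: Y rule: less_induct)
  case less
  show ?case
  proof (cases "Y - X = {l}")
    case True
    have "card X = card Y"
      using exchange_family_card_eq[OF ex \<open>X \<in> \<B>\<close> less.prems(1)] .
    then have "card (X - Y) = card (Y - X)"
      using card_Diff_subset_Int[of X Y] card_Diff_subset_Int[of Y X] by (simp add: Int_commute)
    then have "card (X - Y) = 1" using True by simp
    then obtain b where b: "X - Y = {b}" by (rule card_1_singletonE)
    then have "Y = insert l (X - {b})" using True by blast
    then show ?thesis using b less.prems by blast
  next
    case False
    then obtain i where i: "i \<in> Y" "i \<notin> X" "i \<noteq> l"
      using less.prems \<open>l \<notin> X\<close> by blast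
    then obtain j where j: "j \<in> X" "j \<notin> Y" "insert j (Y - {i}) \<in> \<B>"
      using exchange_familyE[OF ex less.prems(1) \<open>X \<in> \<B>\<close>] by metis
    have "insert j (Y - {i}) - X \<subset> Y - X" using i j by auto
    then have "card (insert j (Y - {i}) - X) < card (Y - X)"
      by (rule psubset_card_mono[OF finite])
    moreover have "l \<in> insert j (Y - {i})" using i less.prems by simp
    ultimately show ?thesis using less.hyps j(3) by simp
  qed
qed

lemma sum_power2_lessThan: "(\<Sum>k<n. 2 ^ k :: nat) < 2 ^ n"
  by (induction n) auto

text \<open>
  Binary numbers are compared at their highest differing digit.
\<close>

lemma binary_weight_less:
  fixes f :: "'a::finite \<Rightarrow> nat"
  assumes "inj f" and m: "m \<in> Y" "m \<notin> X" and below: "\<And>x. x \<in> X - Y \<Longrightarrow> f x < f m"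
  shows "(\<Sum>x\<in>X. 2 ^ f x :: nat) < (\<Sum>y\<in>Y. 2 ^ f y)"
proof -
  let ?w = "\<lambda>A. \<Sum>x\<in>A. 2 ^ f x :: nat"
  have "?w (X - Y) = (\<Sum>k\<in>f ` (X - Y). 2 ^ k)"
    by (simp only: sum.reindex[OF inj_on_subset[OF \<open>inj f\<close> subset_UNIV]] o_def)
  also have "\<dots> \<le> (\<Sum>k<f m. 2 ^ k)"
    using below by (intro sum_mono2) auto
  also have "\<dots> < 2 ^ f m" by (rule sum_power2_lessThan)
  also have "\<dots> \<le> ?w (Y - X)"
    using m by (intro member_le_sum) auto
  finally have "?w (X - Y) < ?w (Y - X)" .
  moreover have "?w X = ?w (X \<inter> Y) + ?w (X - Y)" by (rule sum.Int_Diff) simp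
  moreover have "?w Y = ?w (X \<inter> Y) + ?w (Y - X)"
    by (subst Int_commute) (rule sum.Int_Diff, simp)
  ultimately show ?thesis by linarith
qed

text \<open>
  The combinatorial content of linear quotients: a weight under which a member \<open>Y\<close> that is not
  lighter than \<open>X\<close> can be made lighter by a single exchange that brings in an element of \<open>X\<close>.
\<close>

lemma exchange_family_weight:
  fixes \<B> :: "'a::finite set set"
  assumes ex: "exchange_family \<B>"
  obtains w :: "'a set \<Rightarrow> nat" where
    "\<And>X Y. X \<in> \<B> \<Longrightarrow> Y \<in> \<B> \<Longrightarrow> X \<noteq> Y \<Longrightarrow> w X \<le> w Y \<Longrightarrow>
       \<exists>l\<in>X - Y. \<exists>b\<in>Y. insert l (Y - {b}) \<in> \<B> \<and> w (insert l (Y - {b})) < w Y"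
proof -
  obtain f :: "'a \<Rightarrow> nat" where f: "inj f"
    using finite_imp_inj_to_nat_seg[OF finite[of UNIV]] by metis
  define w where "w X = (\<Sum>x\<in>X. 2 ^ f x :: nat)" for X
  have "\<exists>l\<in>X - Y. \<exists>b\<in>Y. insert l (Y - {b}) \<in> \<B> \<and> w (insert l (Y - {b})) < w Y"
    if XY: "X \<in> \<B>" "Y \<in> \<B>" "X \<noteq> Y" "w X \<le> w Y" for X Y
  proof -
    let ?D = "(X - Y) \<union> (Y - X)"
    have "?D \<noteq> {}" using XY by blast
    then have "Max (f ` ?D) \<in> f ` ?D" by (intro Max_in) auto
    then obtain m where m: "Max (f ` ?D) = f m" "m \<in> ?D" by (rule imageE)
    \<comment> \<open>\<open>f m\<close> is the position of the highest digit in which the weights of \<open>X\<close> and \<open>Y\<close> differ.\<close>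
    have top: "f x < f m" if "x \<in> ?D" "x \<noteq> m" for x
    proof -
      have "f x \<le> f m" unfolding m(1)[symmetric] using that by (intro Max_ge) auto
      moreover have "f x \<noteq> f m" using f that by (meson injD)
      ultimately show ?thesis by simp
    qed
    have "m \<in> Y - X"
    proof (rule ccontr)
      assume "m \<notin> Y - X"
      then have "m \<in> X" "m \<notin> Y" using m by auto
      then have "w Y < w X"
        unfolding w_def using f top by (intro binary_weight_less) auto
      then show False using XY by simp
    qed
    then obtain l where l: "l \<in> X" "l \<notin> Y" "insert l (Y - {m}) \<in> \<B>"
      using exchange_familyE[OF ex XY(2,1)] by blast
    \<comment> \<open>The new element \<open>l\<close> lies in the symmetric difference, hence below \<open>m\<close>.\<close>
    have "w (insert l (Y - {m})) < w Y"
      unfolding w_def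
    proof (rule binary_weight_less[OF f])
      show "m \<in> Y" "m \<notin> insert l (Y - {m})" using \<open>m \<in> Y - X\<close> l by auto
      show "f x < f m" if "x \<in> insert l (Y - {m}) - Y" for x
        using that l \<open>m \<in> Y - X\<close> by (intro top) auto
    qed
    then show ?thesis using l \<open>m \<in> Y - X\<close> by blast
  qed
  then show ?thesis by (rule that)
qed

section \<open>Square-free monomials and their supports\<close>

lemma msupp_add: "msupp (s + t) = msupp s \<union> msupp t"
  by (auto simp: msupp_def lookup_add)

lemma msupp_var_exp [simp]: "msupp (var_exp i) = {i}"
  by (auto simp: msupp_def var_exp_def lookup_single when_def)

lemma squarefree_lookup:
  assumes "squarefree_monomial u"
  shows "Poly_Mapping.lookup u i = (if i \<in> msupp u then 1 else 0)"
proof -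
  have "Poly_Mapping.lookup u i \<le> 1" using assms unfolding squarefree_monomial_def ..
  then show ?thesis by (auto simp: msupp_def)
qed

lemma squarefree_msupp_inject:
  assumes "squarefree_monomial u" "squarefree_monomial v" "msupp u = msupp v"
  shows "u = v"
  by (rule poly_mapping_eqI) (simp add: squarefree_lookup assms)

lemma squarefree_mdeg:
  assumes "squarefree_monomial u"
  shows "mdeg u = card (msupp u)"
  by (simp add: mdeg_def squarefree_lookup[OF assms] sum.If_cases)

lemma finite_squarefree: "finite {u :: 'n::finite monomial. squarefree_monomial u}"
proof (rule finite_imageD)
  show "inj_on msupp {u :: 'n monomial. squarefree_monomial u}"
    by (rule inj_onI) (simp add: squarefree_msupp_inject)
qed simp

text \<open>Divisibility of a monomial by a square-free one depends only on the supports.\<close>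

lemma squarefree_divides_iff:
  assumes "squarefree_monomial u"
  shows "(\<exists>r. t = u + r) \<longleftrightarrow> msupp u \<subseteq> msupp t"
proof
  assume "\<exists>r. t = u + r"
  then show "msupp u \<subseteq> msupp t" by (auto simp: msupp_add)
next
  assume sub: "msupp u \<subseteq> msupp t"
  have "Poly_Mapping.lookup u i \<le> Poly_Mapping.lookup t i" for i
  proof (cases "i \<in> msupp u")
    case True
    then have "Poly_Mapping.lookup t i \<noteq> 0" using sub by (auto simp: msupp_def)
    then show ?thesis by (simp add: squarefree_lookup[OF assms])
  qed (simp add: squarefree_lookup[OF assms])
  then have "t = u + (t - u)"
    by (intro poly_mapping_eqI) (simp add: lookup_add lookup_minus)
  then show "\<exists>r. t = u + r" ..
qed

lemma squarefree_var_exp: "squarefree_monomial (var_exp i)"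
  by (simp add: squarefree_monomial_def var_exp_def lookup_single when_def)

lemma msupp_exchange:
  assumes "squarefree_monomial u" "i \<in> msupp u" "j \<notin> msupp u"
  shows "msupp (var_exp j + u - var_exp i) = insert j (msupp u - {i})"
proof -
  have "Poly_Mapping.lookup (var_exp j + u - var_exp i) k \<noteq> 0 \<longleftrightarrow>
      k = j \<or> k \<in> msupp u \<and> k \<noteq> i" for k
    using assms(2,3)
    by (auto simp: lookup_add lookup_minus squarefree_lookup[OF assms(1)] var_exp_def
        lookup_single when_def)
  then show ?thesis by (auto simp: msupp_def)
qed

lemma matroidal_exchange_family:
  assumes "matroidal I"
  shows "exchange_family (msupp ` min_gens I)"
  unfolding exchange_family_def
proof (intro ballI)
  fix X Y i
  assume "X \<in> msupp ` min_gens I" "Y \<in> msupp ` min_gens I" and i: "i \<in> X - Y"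
  then obtain u v where uv: "u \<in> min_gens I" "v \<in> min_gens I" "X = msupp u" "Y = msupp v"
    by blast
  have sq: "squarefree_monomial u" "squarefree_monomial v"
    using assms uv unfolding matroidal_def by auto
  have "Poly_Mapping.lookup u i > Poly_Mapping.lookup v i"
    using i uv by (simp add: squarefree_lookup[OF sq(1)] squarefree_lookup[OF sq(2)])
  then obtain j where j: "Poly_Mapping.lookup u j < Poly_Mapping.lookup v j"
    "var_exp j + u - var_exp i \<in> min_gens I"
    using assms uv unfolding matroidal_def by blast
  have "j \<in> Y - X"
    using j(1) uv
    by (auto simp: squarefree_lookup[OF sq(1)] squarefree_lookup[OF sq(2)] split: if_splits)
  moreover have "insert j (X - {i}) = msupp (var_exp j + u - var_exp i)"
    using msupp_exchange[OF sq(1), of i j] i uv \<open>j \<in> Y - X\<close> by simp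
  ultimately show "\<exists>j\<in>Y - X. insert j (X - {i}) \<in> msupp ` min_gens I"
    using j(2) by blast
qed

section \<open>Membership in ideals generated by monomials\<close>

lemma poly_mapping_sum_single:
  fixes f :: "'a \<Rightarrow>\<^sub>0 'b::comm_monoid_add"
  shows "f = (\<Sum>t\<in>Poly_Mapping.keys f. Poly_Mapping.single t (Poly_Mapping.lookup f t))"
proof (rule poly_mapping_eqI)
  fix k
  show "Poly_Mapping.lookup f k =
      Poly_Mapping.lookup (\<Sum>t\<in>Poly_Mapping.keys f. Poly_Mapping.single t (Poly_Mapping.lookup f t)) k"
    by (simp add: lookup_sum lookup_single when_def sum.delta in_keys_iff)
qed

text \<open>
  The polynomials all of whose monomials are divisible by a member of \<open>S\<close> form an ideal, because
  the monomials of a product are among the products of monomials; and each term of such a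
  polynomial is a multiple of a generator. This reduces all questions about the ideals below to
  divisibility of monomials.
\<close>

lemma mem_monomial_ideal_iff:
  fixes f :: "('n, 'k::field) polyring"
  shows "f \<in> ideal_gen (xpow ` S) \<longleftrightarrow> (\<forall>t\<in>Poly_Mapping.keys f. \<exists>s\<in>S. \<exists>r. t = s + r)"
proof
  let ?T = "{f :: ('n, 'k) polyring. \<forall>t\<in>Poly_Mapping.keys f. \<exists>s\<in>S. \<exists>r. t = s + r}"
  assume "f \<in> ideal_gen (xpow ` S)"
  moreover have "ideal_gen (xpow ` S) \<subseteq> ?T"
    unfolding ideal_gen_def
  proof (rule module.span_minimal[OF module_times])
    have "\<exists>s'\<in>S. \<exists>r. s = s' + r" if "s \<in> S" for s
      using that by (intro bexI[of _ s] exI[of _ 0]) simp_all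
    then show "xpow ` S \<subseteq> ?T"
      by (simp add: xpow_def image_subset_iff)
    show "module.subspace (*) ?T"
    proof (rule module.subspaceI[OF module_times])
      show "0 \<in> ?T" by simp
      show "f + g \<in> ?T" if "f \<in> ?T" "g \<in> ?T" for f g
        using that keys_add[of f g] by blast
      show "c * f \<in> ?T" if f: "f \<in> ?T" for c f
      proof (intro CollectI ballI)
        fix t assume "t \<in> Poly_Mapping.keys (c * f)"
        then obtain a b where ab: "t = a + b" "b \<in> Poly_Mapping.keys f"
          using keys_mult[of c f] by blast
        then obtain s r where "s \<in> S" "b = s + r" using f by blast
        then have "t = s + (a + r)" using ab by (simp add: ac_simps)
        then show "\<exists>s\<in>S. \<exists>r. t = s + r" using \<open>s \<in> S\<close> by blast
      qed
    qed
  qed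
  ultimately show "\<forall>t\<in>Poly_Mapping.keys f. \<exists>s\<in>S. \<exists>r. t = s + r" by blast
next
  assume div: "\<forall>t\<in>Poly_Mapping.keys f. \<exists>s\<in>S. \<exists>r. t = s + r"
  have "Poly_Mapping.single t (Poly_Mapping.lookup f t) \<in> ideal_gen (xpow ` S)"
    if t: "t \<in> Poly_Mapping.keys f" for t
  proof -
    obtain s r where sr: "s \<in> S" "t = s + r" using div t by blast
    have "Poly_Mapping.single t (Poly_Mapping.lookup f t) = Poly_Mapping.single r (Poly_Mapping.lookup f t) * xpow s"
      by (simp add: sr(2) xpow_def mult_single add.commute)
    also have "\<dots> \<in> ideal_gen (xpow ` S)"
      unfolding ideal_gen_def using sr(1)
      by (intro module.span_scale[OF module_times] module.span_base[OF module_times]) auto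
    finally show ?thesis .
  qed
  then have "(\<Sum>t\<in>Poly_Mapping.keys f. Poly_Mapping.single t (Poly_Mapping.lookup f t)) \<in> ideal_gen (xpow ` S)"
    unfolding ideal_gen_def by (rule module.span_sum[OF module_times])
  then show "f \<in> ideal_gen (xpow ` S)" by (simp flip: poly_mapping_sum_single)
qed

lemma mem_var_ideal_iff:
  fixes f :: "('n, 'k::field) polyring"
  shows "f \<in> ideal_gen (var ` V) \<longleftrightarrow> (\<forall>t\<in>Poly_Mapping.keys f. msupp t \<inter> V \<noteq> {})"
proof -
  have "(var :: 'n \<Rightarrow> ('n, 'k) polyring) ` V = xpow ` var_exp ` V"
    by (auto simp: var_def)
  then show ?thesis
    by (auto simp: mem_monomial_ideal_iff squarefree_divides_iff[OF squarefree_var_exp])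
qed

lemma keys_mult_xpow:
  fixes f :: "('n, 'k::field) polyring"
  shows "Poly_Mapping.keys (f * xpow u) = (\<lambda>t. t + u) ` Poly_Mapping.keys f"
proof
  show "Poly_Mapping.keys (f * xpow u) \<subseteq> (\<lambda>t. t + u) ` Poly_Mapping.keys f"
    using keys_mult[of f "xpow u"] by (auto simp: xpow_def)
  have "f * xpow u =
      (\<Sum>t\<in>Poly_Mapping.keys f. Poly_Mapping.single (t + u) (Poly_Mapping.lookup f t))"
    by (subst poly_mapping_sum_single[of f]) (simp add: sum_distrib_right xpow_def mult_single)
  then have "Poly_Mapping.lookup (f * xpow u) (t + u) = Poly_Mapping.lookup f t"
    if "t \<in> Poly_Mapping.keys f" for t
    using that by (simp add: lookup_sum lookup_single when_def sum.delta)
  then show "(\<lambda>t. t + u) ` Poly_Mapping.keys f \<subseteq> Poly_Mapping.keys (f * xpow u)"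
    by (auto simp: in_keys_iff)
qed

section \<open>Colon ideals of a list of square-free monomials\<close>

lemma mem_step_colon_iff:
  fixes f :: "('n, 'k::field) polyring"
  assumes sq: "\<And>u. u \<in> set us \<Longrightarrow> squarefree_monomial u" and j: "j < length us"
  shows "f \<in> step_colon us j \<longleftrightarrow>
    (\<forall>t\<in>Poly_Mapping.keys f. \<exists>k<j. msupp (us ! k) \<subseteq> msupp t \<union> msupp (us ! j))"
proof -
  have take: "set (take j us) = (!) us ` {..<j}"
    using nth_image[of j us] j by (simp add: lessThan_atLeast0)
  have "(\<exists>r. t = us ! k + r) \<longleftrightarrow> msupp (us ! k) \<subseteq> msupp t" if "k < j" for k t
    using that j by (intro squarefree_divides_iff sq) simp
  then show ?thesis
    unfolding step_colon_def colon_def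
    by (simp add: mem_monomial_ideal_iff keys_mult_xpow take msupp_add Bex_def cong: conj_cong)
qed

text \<open>
  For a list of square-free monomials, the condition says that an earlier one divides \<open>x\<^sub>l u\<^sub>j\<close>,
  so these are the variables in the colon ideal of step \<open>j\<close>.
\<close>

definition step_vars :: "'n monomial list \<Rightarrow> nat \<Rightarrow> 'n set" where
  "step_vars us j = {l. \<exists>k<j. msupp (us ! k) \<subseteq> insert l (msupp (us ! j))}"

text \<open>
  A variable lies in an ideal generated by variables only if it is one of the generators, so
  membership of the single variables determines the generating set.
\<close>

lemma step_vars_unique:
  assumes sq: "\<And>u. u \<in> set us \<Longrightarrow> squarefree_monomial u" and j: "j < length us"
    and V: "(step_colon us j :: ('n, 'k::field) polyring set) = ideal_gen (var ` V)"
  shows "V = step_vars us j"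
proof -
  have "l \<in> V \<longleftrightarrow> l \<in> step_vars us j" for l
  proof -
    have "(var l :: ('n, 'k) polyring) \<in> ideal_gen (var ` V) \<longleftrightarrow> l \<in> V"
      unfolding mem_var_ideal_iff by (simp add: var_def xpow_def)
    moreover have "(var l :: ('n, 'k) polyring) \<in> step_colon us j \<longleftrightarrow> l \<in> step_vars us j"
      using mem_step_colon_iff[OF sq j, of "var l :: ('n, 'k) polyring"]
      by (simp add: var_def xpow_def step_vars_def)
    ultimately show ?thesis using V by simp
  qed
  then show ?thesis by blast
qed

lemma q_step_eq_card_step_vars:
  fixes I :: "('n::finite, 'k::field) polyring set"
  assumes sq: "\<And>u. u \<in> set us \<Longrightarrow> squarefree_monomial u" and j: "j < length us"
    and "\<exists>V. (step_colon us j :: ('n, 'k) polyring set) = ideal_gen (var ` V)"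
  shows "q_step I us j = card (step_vars us j)"
proof -
  obtain V where "(step_colon us j :: ('n, 'k) polyring set) = ideal_gen (var ` V)"
    using assms by blast
  then have "(step_colon us j :: ('n, 'k) polyring set) = ideal_gen (var ` W) \<longleftrightarrow>
      W = step_vars us j" for W
    using step_vars_unique[OF sq j] by metis
  then show ?thesis
    unfolding q_step_def by (intro Least_equality) auto
qed

text \<open>
  The witness condition says that the generator \<open>u\<^sub>i / gcd(u\<^sub>i, u\<^sub>j)\<close> of the colon ideal, whose
  support is \<open>msupp (us ! i) - msupp (us ! j)\<close>, is divisible by a variable of the colon ideal.
\<close>

lemma step_colon_eq_var_ideal:
  assumes sq: "\<And>u. u \<in> set us \<Longrightarrow> squarefree_monomial u" and j: "j < length us"
    and wit: "\<And>i. i < j \<Longrightarrow> \<exists>l\<in>msupp (us ! i) - msupp (us ! j). l \<in> step_vars us j"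
  shows "(step_colon us j :: ('n, 'k::field) polyring set) = ideal_gen (var ` step_vars us j)"
proof -
  have "(\<exists>k<j. msupp (us ! k) \<subseteq> msupp t \<union> msupp (us ! j)) \<longleftrightarrow> msupp t \<inter> step_vars us j \<noteq> {}"
    (is "?L \<longleftrightarrow> ?R") for t :: "'n monomial"
  proof
    show ?R if ?L using that wit by blast
    show ?L if ?R using that unfolding step_vars_def by blast
  qed
  then show ?thesis
    by (intro set_eqI) (simp only: mem_step_colon_iff[OF sq j] mem_var_ideal_iff)
qed

section \<open>Matroidal ideals\<close>

text \<open>
  Sort the generators by the weight from \<open>exchange_family_weight\<close>: the lighter generator
  obtained by the exchange is then an earlier one.
\<close>

lemma matroidal_linear_quotient_ordering:
  fixes I :: "('n::finite, 'k::field) polyring set"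
  assumes "matroidal I"
  obtains us where "linear_quotient_ordering I us"
proof -
  let ?G = "min_gens I"
  have sq: "squarefree_monomial u" if "u \<in> ?G" for u
    using assms that unfolding matroidal_def by blast
  note ex = matroidal_exchange_family[OF assms]
  obtain w :: "'n set \<Rightarrow> nat" where
    w: "\<And>X Y. X \<in> msupp ` ?G \<Longrightarrow> Y \<in> msupp ` ?G \<Longrightarrow> X \<noteq> Y \<Longrightarrow> w X \<le> w Y \<Longrightarrow>
       \<exists>l\<in>X - Y. \<exists>b\<in>Y. insert l (Y - {b}) \<in> msupp ` ?G \<and> w (insert l (Y - {b})) < w Y"
    using exchange_family_weight[OF ex] by metis
  have "finite ?G"
    using finite_subset[OF _ finite_squarefree] sq by blast
  then obtain us0 where us0: "set us0 = ?G" "distinct us0"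
    using finite_distinct_list by blast
  define us where "us = sort_key (w \<circ> msupp) us0"
  have us: "set us = ?G" "distinct us" "sorted (map (w \<circ> msupp) us)"
    using us0 by (simp_all add: us_def)
  have mono: "w (msupp (us ! i)) \<le> w (msupp (us ! j))" if "i \<le> j" "j < length us" for i j
    using sorted_nth_mono[OF us(3), of i j] that by simp
  have "(step_colon us j :: ('n, 'k) polyring set) = ideal_gen (var ` step_vars us j)"
    if j: "j < length us" for j
  proof (rule step_colon_eq_var_ideal)
    show "squarefree_monomial u" if "u \<in> set us" for u using sq us that by simp
    show "j < length us" by (rule j)
    fix i assume i: "i < j"
    have G: "us ! i \<in> ?G" "us ! j \<in> ?G" using us i j nth_mem[of _ us] by auto
    have "us ! i \<noteq> us ! j" using us(2) i j by (simp add: nth_eq_iff_index_eq)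
    then have "msupp (us ! i) \<noteq> msupp (us ! j)"
      using squarefree_msupp_inject sq G by blast
    then obtain l b where l: "l \<in> msupp (us ! i) - msupp (us ! j)"
      and Z: "insert l (msupp (us ! j) - {b}) \<in> msupp ` ?G"
        "w (insert l (msupp (us ! j) - {b})) < w (msupp (us ! j))"
      using w[of "msupp (us ! i)" "msupp (us ! j)"] G mono[of i j] i j by auto
    obtain k where k: "k < length us" "msupp (us ! k) = insert l (msupp (us ! j) - {b})"
      using Z(1) us(1) by (metis (no_types, lifting) image_iff in_set_conv_nth)
    have "k < j" using mono[of j k] k Z(2) by (metis linorder_not_le)
    then have "l \<in> step_vars us j" unfolding step_vars_def using k by blast
    then show "\<exists>l\<in>msupp (us ! i) - msupp (us ! j). l \<in> step_vars us j" using l by blast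
  qed
  moreover have "mdeg u = mdeg v" if "u \<in> ?G" "v \<in> ?G" for u v
    using exchange_family_card_eq[OF ex, of "msupp u" "msupp v"] that
    by (simp add: squarefree_mdeg sq)
  then have "mdeg (us ! i) = mdeg (us ! j)" if "i < length us" "j < length us" for i j
    using that nth_mem us(1) by blast
  then have "sorted (map mdeg us)"
    unfolding sorted_iff_nth_mono by (metis dual_order.refl length_map nth_map order_le_less_trans)
  ultimately have "linear_quotient_ordering I us"
    unfolding linear_quotient_ordering_def using us by auto
  then show ?thesis by (rule that)
qed

text \<open>
  The upper bound \<open>q\<^sub>j \<le> n - d\<close>: a variable of \<open>u\<^sub>j\<close> in the colon ideal would make an earlier
  generator of the same degree divide \<open>u\<^sub>j\<close>.
\<close>

lemma step_vars_disjoint: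
  assumes sq: "\<And>u. u \<in> set us \<Longrightarrow> squarefree_monomial u" and "distinct us"
    and card: "\<And>u. u \<in> set us \<Longrightarrow> card (msupp u) = d" and j: "j < length us"
  shows "step_vars us j \<subseteq> - msupp (us ! j :: 'n::finite monomial)"
proof
  fix l assume "l \<in> step_vars us j"
  then obtain k where k: "k < j" "msupp (us ! k) \<subseteq> insert l (msupp (us ! j))"
    unfolding step_vars_def by blast
  show "l \<in> - msupp (us ! j)"
  proof
    assume "l \<in> msupp (us ! j)"
    then have "msupp (us ! k) \<subseteq> msupp (us ! j)" using k by blast
    moreover have "card (msupp (us ! k)) = card (msupp (us ! j))"
      using card j k by simp
    ultimately have "msupp (us ! k) = msupp (us ! j)"
      by (intro card_subset_eq) auto
    moreover have "us ! k \<in> set us" "us ! j \<in> set us" using j k by auto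
    ultimately have "us ! k = us ! j" by (intro squarefree_msupp_inject sq)
    then show False using \<open>distinct us\<close> j k by (simp add: nth_eq_iff_index_eq)
  qed
qed

text \<open>
  The bound is attained at the last step, since every generator other than the last one is
  available there.
\<close>

lemma step_vars_last:
  fixes us :: "'n::finite monomial list"
  assumes ex: "exchange_family (msupp ` set us)"
    and cover: "(\<Union>u\<in>set us. msupp u) = UNIV" and "us \<noteq> []"
  shows "- msupp (last us) \<subseteq> step_vars us (length us - 1)"
proof
  fix l assume l: "l \<in> - msupp (last us)"
  obtain v where "v \<in> set us" "l \<in> msupp v" using cover by blast
  then obtain b where "insert l (msupp (last us) - {b}) \<in> msupp ` set us"
    using exchange_family_insert_point[OF ex, of "msupp (last us)" "msupp v" l] l \<open>us \<noteq> []\<close>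
    by auto
  then obtain k where k: "k < length us" "msupp (us ! k) = insert l (msupp (last us) - {b})"
    by (metis (no_types, lifting) image_iff in_set_conv_nth)
  then have "k \<noteq> length us - 1" using l \<open>us \<noteq> []\<close> by (auto simp: last_conv_nth)
  then have "k < length us - 1" using k by simp
  then show "l \<in> step_vars us (length us - 1)"
    unfolding step_vars_def using k \<open>us \<noteq> []\<close> by (auto simp: last_conv_nth)
qed

text \<open>
  For a single generator the convention \<open>q(I) = 0\<close> agrees with the formula: its support is then
  the set of all variables, so \<open>d = n\<close>.
\<close>

lemma q_ordering_matroidal:
  fixes I :: "('n::finite, 'k::field) polyring set"
  assumes mat: "matroidal I" and supp: "ideal_supp I = UNIV"
    and deg: "\<And>u. u \<in> min_gens I \<Longrightarrow> mdeg u = d"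
    and lq: "linear_quotient_ordering I us"
  shows "q_ordering I us = CARD('n) - d"
proof -
  have us: "set us = min_gens I" "distinct us"
    using lq unfolding linear_quotient_ordering_def by auto
  have sq: "squarefree_monomial u" if "u \<in> set us" for u
    using mat that us unfolding matroidal_def by blast
  have card: "card (msupp u) = d" if "u \<in> set us" for u
    using deg[of u] squarefree_mdeg[OF sq[OF that]] us(1) that by simp
  have cover: "(\<Union>u\<in>set us. msupp u) = UNIV"
    using supp us by (simp add: ideal_supp_def)
  then have "us \<noteq> []" by auto
  have q: "q_step I us j = card (step_vars us j)" if "j \<in> {1..<length us}" for j
  proof (rule q_step_eq_card_step_vars[OF sq])
    show "j < length us" using that by simp
    show "\<exists>V. (step_colon us j :: ('n, 'k) polyring set) = ideal_gen (var ` V)"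
      using lq that unfolding linear_quotient_ordering_def by blast
  qed
  have compl: "card (- msupp u) = CARD('n) - d" if "u \<in> set us" for u
    unfolding Compl_eq_Diff_UNIV using card[OF that] by (subst card_Diff_subset) simp_all
  show ?thesis
  proof (cases "length us \<le> 1")
    case True
    then obtain u where "us = [u]"
      using \<open>us \<noteq> []\<close> by (cases us) auto
    then have "d = card (msupp u)" "msupp u = UNIV" using cover card[of u] by simp_all
    then have "d = CARD('n)" by simp
    then show ?thesis using True by (simp add: q_ordering_def)
  next
    case False
    let ?s = "length us - 1"
    have "Max (q_step I us ` {1..<length us}) = CARD('n) - d"
    proof (rule Max_eqI)
      show "finite (q_step I us ` {1..<length us})" by simp
      fix m assume "m \<in> q_step I us ` {1..<length us}"
      then obtain j where j: "j \<in> {1..<length us}" "m = card (step_vars us j)"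
        using q by auto
      have "step_vars us j \<subseteq> - msupp (us ! j)"
        by (rule step_vars_disjoint[OF sq us(2) card]) (use j in auto)
      then have "m \<le> card (- msupp (us ! j))"
        unfolding j(2) by (intro card_mono) auto
      then show "m \<le> CARD('n) - d" using compl[of "us ! j"] j(1) by simp
    next
      have s: "?s \<in> {1..<length us}" "us ! ?s = last us"
        using False \<open>us \<noteq> []\<close> by (auto simp: last_conv_nth)
      have "step_vars us ?s \<subseteq> - msupp (last us)"
        unfolding s(2)[symmetric] by (rule step_vars_disjoint[OF sq us(2) card]) (use s in auto)
      moreover have "- msupp (last us) \<subseteq> step_vars us ?s"
        using matroidal_exchange_family[OF mat]
        by (intro step_vars_last cover \<open>us \<noteq> []\<close>) (simp add: us(1))
      ultimately have "step_vars us ?s = - msupp (last us)" by simp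
      then have "q_step I us ?s = CARD('n) - d"
        using q[OF s(1)] compl[of "last us"] \<open>us \<noteq> []\<close> by simp
      then show "CARD('n) - d \<in> q_step I us ` {1..<length us}"
        using imageI[OF s(1), of "q_step I us"] by simp
    qed
    then show ?thesis using False by (simp add: q_ordering_def)
  qed
qed

theorem theorem2p5:
  fixes I :: "('n::finite, 'k::field) polyring set" and d :: nat
  assumes "matroidal I"
    and "ideal_degree I = d"
    and "ideal_supp I = (UNIV :: 'n set)"
  shows "int (q_ideal I) = int CARD('n) - int d"
proof -
  have sq: "squarefree_monomial u" if "u \<in> min_gens I" for u
    using assms(1) that unfolding matroidal_def by blast
  have eq: "mdeg u = mdeg v" if "u \<in> min_gens I" "v \<in> min_gens I" for u v
    using exchange_family_card_eq[OF matroidal_exchange_family[OF assms(1)]] that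
    by (simp add: squarefree_mdeg sq)
  obtain u where u: "u \<in> min_gens I"
    using assms(3) unfolding ideal_supp_def by blast
  have "ideal_degree I = mdeg u"
    unfolding ideal_degree_def
  proof (rule the_equality)
    show "\<forall>v\<in>min_gens I. mdeg v = mdeg u" using eq u by blast
    show "e = mdeg u" if "\<forall>v\<in>min_gens I. mdeg v = e" for e using that u by simp
  qed
  then have deg: "mdeg v = d" if "v \<in> min_gens I" for v
    using eq[OF that u] assms(2) by simp
  have q: "q_ordering I us = CARD('n) - d" if "linear_quotient_ordering I us" for us
    using q_ordering_matroidal[OF assms(1,3) deg that] .
  obtain us where us: "linear_quotient_ordering I us"
    using matroidal_linear_quotient_ordering[OF assms(1)] .
  have "q_ideal I = CARD('n) - d"
    unfolding q_ideal_def
  proof (rule the_equality)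
    show "\<exists>us. linear_quotient_ordering I us \<and> CARD('n) - d = q_ordering I us"
      using q[OF us] us by metis
    show "r = CARD('n) - d" if "\<exists>us. linear_quotient_ordering I us \<and> r = q_ordering I us" for r
      using that q by blast
  qed
  moreover have "d \<le> CARD('n)"
    using deg[OF u] squarefree_mdeg[OF sq[OF u]] card_mono[of UNIV "msupp u"] by simp
  ultimately show ?thesis by simp
qed

end
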